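(* Let $\mathcal{L}$ be a finite bounded lattice with least element $\hat 0$ and greatest element $\hat 1$, let $x \in \mathcal{L}\setminus\{\hat 0,\hat 1\}$, and let $P = \mathcal{L}\setminus \mathrm{Co}_{\mathcal{L}}(x)$, where $\mathrm{Co}_{\mathcal{L}}(x)=\{y\in\mathcal{L} : x\wedge y=\hat 0 \text{ and } x\vee y=\hat 1\}$ is the set of complements of $x$. Let $\bar P = P\setminus\{\hat 0,\hat 1\}$. Then the order complex $\Delta(\bar P)$ is nonevasive; in particular it is collapsible.
   Context: For a finite poset $Q$, the order complex $\Delta(Q)$ is the abstract simplicial complex on vertex set $Q$ whose faces are the chains (totally ordered subsets) of $Q$. For a simplicial complex $\Delta$ and a vertex $v$, the deletion $\mathrm{dl}_\Delta(v)$ is the subcomplex of faces not containing $v$, and the link $\mathrm{lk}_\Delta(v)$ is the set of faces $\sigma$ with $v\notin\sigma$ and $\sigma\cup\{v\}\in\Delta$. A simplicial complex $\Delta$ on a finite vertex set is nonevasive if either it consists of a single vertex, or there exists a vertex $v$ such that both $\mathrm{dl}_\Delta(v)$ and $\mathrm{lk}_\Delta(v)$ are nonevasive. A simplicial complex is collapsible if it can be reduced to a single point by a sequence of elementary collapses, where an elementary collapse removes a pair of faces $\sigma\subsetneq\tau$ such that $\sigma$ is a proper face of exactly one face, namely $\tau$. *)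

theory Defs
  imports Main
begin

text \<open>
  A simplicial complex is represented by its set of faces, the empty face included; its vertices
  are the \<open>v\<close> for which \<open>{v}\<close> is a face.  In particular the complex consisting of the single
  vertex \<open>v\<close> is \<open>{{}, {v}}\<close>.
\<close>

definition simplicial_complex :: "'a set set \<Rightarrow> bool" where
  "simplicial_complex \<Delta> \<longleftrightarrow>
     {} \<in> \<Delta> \<and> (\<forall>\<sigma>\<in>\<Delta>. finite \<sigma>) \<and> (\<forall>\<sigma>\<in>\<Delta>. \<forall>\<rho>. \<rho> \<subseteq> \<sigma> \<longrightarrow> \<rho> \<in> \<Delta>)"

definition order_complex :: "'a::order set \<Rightarrow> 'a set set" where
  "order_complex Q = {C. C \<subseteq> Q \<and> Complete_Partial_Order.chain (\<le>) C}"

definition deletion :: "'a set set \<Rightarrow> 'a \<Rightarrow> 'a set set" where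
  "deletion \<Delta> v = {\<sigma> \<in> \<Delta>. v \<notin> \<sigma>}"

definition link :: "'a set set \<Rightarrow> 'a \<Rightarrow> 'a set set" where
  "link \<Delta> v = {\<sigma>. v \<notin> \<sigma> \<and> insert v \<sigma> \<in> \<Delta>}"

inductive nonevasive :: "'a set set \<Rightarrow> bool" where
  vertex: "nonevasive {{}, {v}}"
| step: "{v} \<in> \<Delta> \<Longrightarrow> nonevasive (deletion \<Delta> v) \<Longrightarrow> nonevasive (link \<Delta> v) \<Longrightarrow> nonevasive \<Delta>"

text \<open>
  In a simplicial complex the condition forces \<open>card \<tau> = card \<sigma> + 1\<close>.  The choice \<open>\<sigma> = {}\<close> is
  possible only in a single vertex and leads to the complex without faces, so it has no effect on
  collapsibility.
\<close>

definition elementary_collapse :: "'a set set \<Rightarrow> 'a set set \<Rightarrow> bool" where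
  "elementary_collapse \<Delta> \<Delta>' \<longleftrightarrow>
     (\<exists>\<sigma>\<in>\<Delta>. \<exists>\<tau>\<in>\<Delta>. \<sigma> \<subset> \<tau> \<and> (\<forall>\<rho>\<in>\<Delta>. \<sigma> \<subset> \<rho> \<longrightarrow> \<rho> = \<tau>) \<and> \<Delta>' = \<Delta> - {\<sigma>, \<tau>})"

definition collapsible :: "'a set set \<Rightarrow> bool" where
  "collapsible \<Delta> \<longleftrightarrow> (\<exists>v. elementary_collapse\<^sup>*\<^sup>* \<Delta> {{}, {v}})"

definition complements :: "'a::bounded_lattice \<Rightarrow> 'a set" where
  "complements x = {y. inf x y = bot \<and> sup x y = top}"

lemma simplicial_complex_order_complex:
  assumes "finite Q"
  shows "simplicial_complex (order_complex Q)"
  using assms by (auto simp: simplicial_complex_def order_complex_def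
      Complete_Partial_Order.chain_def intro: finite_subset)

lemma singleton_in_order_complex_iff: "{v} \<in> order_complex Q \<longleftrightarrow> v \<in> Q"
  by (simp add: order_complex_def Complete_Partial_Order.chain_def)

lemma simplicial_complex_deletion:
  assumes "simplicial_complex \<Delta>"
  shows "simplicial_complex (deletion \<Delta> v)"
  using assms unfolding simplicial_complex_def deletion_def by blast

lemma simplicial_complex_link:
  assumes "simplicial_complex \<Delta>" and "{v} \<in> \<Delta>"
  shows "simplicial_complex (link \<Delta> v)"
proof -
  have "insert v \<rho> \<in> \<Delta>" if "insert v \<sigma> \<in> \<Delta>" "\<rho> \<subseteq> \<sigma>" for \<sigma> \<rho>
    using assms(1) that unfolding simplicial_complex_def by (meson insert_mono)
  moreover have "finite \<sigma>" if "insert v \<sigma> \<in> \<Delta>" for \<sigma>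
    using assms(1) that unfolding simplicial_complex_def by (meson finite_insert)
  ultimately show ?thesis
    using assms(2) unfolding simplicial_complex_def link_def by blast
qed

lemma simplicial_complex_elementary_collapse:
  assumes "simplicial_complex \<Delta>" and "elementary_collapse \<Delta> \<Delta>'" and "\<Delta>' \<noteq> {}"
  shows "simplicial_complex \<Delta>'"
proof -
  from assms(2) obtain \<sigma> \<tau> where st: "\<sigma> \<in> \<Delta>" "\<tau> \<in> \<Delta>" "\<sigma> \<subset> \<tau>"
    and free: "\<And>\<rho>. \<rho> \<in> \<Delta> \<Longrightarrow> \<sigma> \<subset> \<rho> \<Longrightarrow> \<rho> = \<tau>" and eq: "\<Delta>' = \<Delta> - {\<sigma>, \<tau>}"
    unfolding elementary_collapse_def by blast
  have down: "\<rho> \<in> \<Delta>'" if "\<mu> \<in> \<Delta>'" "\<rho> \<subseteq> \<mu>" for \<mu> \<rho>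
  proof -
    have "\<mu> \<in> \<Delta>" "\<mu> \<noteq> \<sigma>" "\<mu> \<noteq> \<tau>" using that(1) eq by auto
    moreover from this have "\<rho> \<in> \<Delta>"
      using assms(1) that(2) unfolding simplicial_complex_def by blast
    moreover have "\<not> \<sigma> \<subseteq> \<mu>" using free[of \<mu>] calculation by blast
    ultimately show ?thesis using st(3) that(2) eq by blast
  qed
  moreover have "{} \<in> \<Delta>'" using assms(3) down by blast
  moreover have "\<forall>\<mu>\<in>\<Delta>'. finite \<mu>"
    using assms(1) eq unfolding simplicial_complex_def by blast
  ultimately show ?thesis unfolding simplicial_complex_def by blast
qed

end

theory Submission
  imports Defs
begin

text \<open>
  For \<open>y\<close> with \<open>x \<sqinter> y = \<bottom>\<close> and \<open>x \<squnion> y \<noteq> \<top>\<close> let \<open>A\<^sub>y\<close> be the set of all \<open>z \<noteq> \<top>\<close> above \<open>y\<close>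
  with \<open>x \<sqinter> z \<noteq> \<bottom>\<close>, and put \<open>w = x \<squnion> y\<close>.  The elements of \<open>A\<^sub>y\<close> below \<open>w\<close> form a cone with
  apex \<open>w\<close>.  The other elements \<open>z\<close> of \<open>A\<^sub>y\<close> can be removed, minimal ones first, since then the
  elements left below \<open>z\<close> form a cone with apex \<open>z \<sqinter> w\<close>.  So \<open>A\<^sub>y\<close> is nonevasive.  The noncomplements
  outside \<open>A\<^sub>\<bottom>\<close> satisfy the conditions on \<open>y\<close>; removing them from the proper part, maximal ones
  first, leaves exactly \<open>A\<^sub>y\<close> above each removed \<open>y\<close>, and ends in \<open>A\<^sub>\<bottom>\<close>.
\<close>

text \<open>With \<open>D\<close> the deletion and \<open>\<Lambda>\<close> the link of
  \<open>v\<close>, the union is the whole complex, so collapses of the link lift to it. Faces of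
  \<open>D\<close> avoid \<open>v\<close>, so the faces containing \<open>insert v \<sigma>\<close>
  come from \<open>\<Lambda>\<close> alone and \<open>\<sigma>\<close> being free carries
  over.\<close>

lemma elementary_collapse_cone:
  assumes "elementary_collapse \<Lambda> \<Lambda>'" and "\<And>\<sigma>. \<sigma> \<in> \<Lambda> \<Longrightarrow> v \<notin> \<sigma>" and "\<And>\<sigma>. \<sigma> \<in> D \<Longrightarrow> v \<notin> \<sigma>"
  shows "elementary_collapse (D \<union> insert v ` \<Lambda>) (D \<union> insert v ` \<Lambda>')"
proof -
  from assms(1) obtain \<sigma> \<tau> where st: "\<sigma> \<in> \<Lambda>" "\<tau> \<in> \<Lambda>" "\<sigma> \<subset> \<tau>"
    and free: "\<And>\<rho>. \<rho> \<in> \<Lambda> \<Longrightarrow> \<sigma> \<subset> \<rho> \<Longrightarrow> \<rho> = \<tau>" and eq: "\<Lambda>' = \<Lambda> - {\<sigma>, \<tau>}"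
    unfolding elementary_collapse_def by blast
  have sub: "insert v \<mu> \<subset> insert v \<nu> \<longleftrightarrow> \<mu> \<subset> \<nu>" if "\<mu> \<in> \<Lambda>" "\<nu> \<in> \<Lambda>" for \<mu> \<nu>
    using assms(2)[OF that(1)] assms(2)[OF that(2)]
    by (simp add: psubset_eq insert_ident subset_insert)
  have inj: "inj_on (insert v) \<Lambda>"
    using assms(2) by (meson inj_onI insert_ident)
  have image: "insert v ` \<Lambda>' = insert v ` \<Lambda> - {insert v \<sigma>, insert v \<tau>}"
    using inj_on_image_set_diff[OF inj, of \<Lambda> "{\<sigma>, \<tau>}"] st eq by auto
  have "\<rho> = insert v \<tau>" if "\<rho> \<in> D \<union> insert v ` \<Lambda>" "insert v \<sigma> \<subset> \<rho>" for \<rho>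
  proof -
    from that assms(3) obtain \<nu> where "\<nu> \<in> \<Lambda>" "\<rho> = insert v \<nu>" by blast
    then show ?thesis using free[of \<nu>] sub[of \<sigma> \<nu>] st(1) that(2) by simp
  qed
  moreover have "D \<union> insert v ` \<Lambda>' = D \<union> insert v ` \<Lambda> - {insert v \<sigma>, insert v \<tau>}"
    using image assms(3) by blast
  moreover have "insert v \<sigma> \<subset> insert v \<tau>"
    using sub[OF st(1,2)] st(3) by simp
  moreover have "insert v \<sigma> \<in> D \<union> insert v ` \<Lambda>" "insert v \<tau> \<in> D \<union> insert v ` \<Lambda>"
    using st(1,2) by blast+
  ultimately show ?thesis
    unfolding elementary_collapse_def by meson
qed

text \<open>The inclusion keeps \<open>v\<close> out of all faces along the sequence, as each single
  lift requires, and later places the final vertex in the link.\<close>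

lemma elementary_collapses_cone:
  assumes "elementary_collapse\<^sup>*\<^sup>* \<Lambda> \<Lambda>'"
    and "\<And>\<sigma>. \<sigma> \<in> \<Lambda> \<Longrightarrow> v \<notin> \<sigma>" and "\<And>\<sigma>. \<sigma> \<in> D \<Longrightarrow> v \<notin> \<sigma>"
  shows "elementary_collapse\<^sup>*\<^sup>* (D \<union> insert v ` \<Lambda>) (D \<union> insert v ` \<Lambda>') \<and> \<Lambda>' \<subseteq> \<Lambda>"
  using assms(1)
proof (induction rule: rtranclp_induct)
  case base
  show ?case by simp
next
  case (step \<Lambda>1 \<Lambda>2)
  have "elementary_collapse (D \<union> insert v ` \<Lambda>1) (D \<union> insert v ` \<Lambda>2)"
    using step assms(2,3) by (intro elementary_collapse_cone) auto
  moreover have "\<Lambda>2 \<subseteq> \<Lambda>1"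
    using step.hyps(2) unfolding elementary_collapse_def by blast
  ultimately show ?case
    using step.IH by (meson order_trans rtranclp.rtrancl_into_rtrancl)
qed

lemma deletion_Un_cone_link: "deletion \<Delta> v \<union> insert v ` link \<Delta> v = \<Delta>"
proof -
  have "\<sigma> \<in> insert v ` link \<Delta> v" if "\<sigma> \<in> \<Delta>" "v \<in> \<sigma>" for \<sigma>
    using that by (intro image_eqI[of _ _ "\<sigma> - {v}"]) (auto simp: link_def insert_absorb)
  then show ?thesis
    by (auto simp: deletion_def link_def)
qed

text \<open>Lifted collapses of the link leave \<open>{v}\<close> and \<open>{v, w}\<close> as the
  only faces containing \<open>v\<close>. Removing this pair gives the deletion, which collapses by
  induction.\<close>

lemma nonevasive_imp_collapsible:
  assumes "nonevasive \<Delta>"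
  shows "collapsible \<Delta>"
  using assms
proof induction
  case (vertex v)
  show ?case unfolding collapsible_def by blast
next
  case (step v \<Delta>)
  let ?D = "deletion \<Delta> v"
  have avoid: "v \<notin> \<sigma>" if "\<sigma> \<in> ?D \<or> \<sigma> \<in> link \<Delta> v" for \<sigma>
    using that by (auto simp: deletion_def link_def)
  obtain w where w: "elementary_collapse\<^sup>*\<^sup>* (link \<Delta> v) {{}, {w}}"
    using step.IH(2) unfolding collapsible_def by blast
  have "elementary_collapse\<^sup>*\<^sup>* \<Delta> (?D \<union> insert v ` {{}, {w}})" and wl: "{w} \<in> link \<Delta> v"
    using elementary_collapses_cone[OF w, of v ?D] avoid by (auto simp: deletion_Un_cone_link)
  moreover have "elementary_collapse (?D \<union> insert v ` {{}, {w}}) ?D"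
  proof -
    let ?E = "?D \<union> insert v ` {{}, {w}}"
    have "{v} \<in> ?E" "{v, w} \<in> ?E" by simp_all
    moreover have "{v} \<subset> {v, w}" using avoid wl by blast
    moreover have "\<forall>\<rho>\<in>?E. {v} \<subset> \<rho> \<longrightarrow> \<rho> = {v, w}"
      using avoid by auto
    moreover have "?D = ?E - {{v}, {v, w}}"
      using avoid by auto
    ultimately show ?thesis
      unfolding elementary_collapse_def by meson
  qed
  moreover obtain u where "elementary_collapse\<^sup>*\<^sup>* ?D {{}, {u}}"
    using step.IH(1) unfolding collapsible_def by blast
  ultimately have "elementary_collapse\<^sup>*\<^sup>* \<Delta> {{}, {u}}"
    by (meson rtranclp.rtrancl_into_rtrancl rtranclp_trans)
  then show ?case unfolding collapsible_def by blast
qed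

lemma order_complex_singleton: "order_complex {a} = {{}, {a}}"
  by (auto simp: order_complex_def Complete_Partial_Order.chain_def subset_singleton_iff)

lemma deletion_order_complex: "deletion (order_complex Q) v = order_complex (Q - {v})"
  by (auto simp: order_complex_def deletion_def)

lemma link_order_complex:
  assumes "v \<in> Q"
  shows "link (order_complex Q) v = order_complex {u \<in> Q. u < v \<or> v < u}"
proof -
  have "v \<notin> \<sigma> \<and> Complete_Partial_Order.chain (\<le>) (insert v \<sigma>) \<longleftrightarrow>
      (\<forall>u\<in>\<sigma>. u < v \<or> v < u) \<and> Complete_Partial_Order.chain (\<le>) \<sigma>" for \<sigma>
    unfolding Complete_Partial_Order.chain_def less_le by blast
  then show ?thesis
    using assms unfolding order_complex_def link_def by blast
qed

lemma nonevasive_order_complex_step: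
  assumes "v \<in> Q" and "nonevasive (order_complex (Q - {v}))"
    and "nonevasive (order_complex {u \<in> Q. u < v \<or> v < u})"
  shows "nonevasive (order_complex Q)"
  using assms nonevasive.step[of v "order_complex Q"]
  by (simp add: singleton_in_order_complex_iff deletion_order_complex link_order_complex)

text \<open>A vertex \<open>v\<close> of \<open>L\<close> is comparable to all of \<open>U\<close>,
  so its deletion and its link are again joins of \<open>U\<close> with a smaller part of
  \<open>L\<close>. The induction ends at \<open>U\<close> itself.\<close>

lemma nonevasive_order_complex_join:
  assumes "finite L" and "nonevasive (order_complex U)"
    and "\<And>l u. l \<in> L \<Longrightarrow> u \<in> U \<Longrightarrow> l < u \<or> u < l"
  shows "nonevasive (order_complex (L \<union> U))"
  using assms(1,3)
proof (induction L rule: finite_psubset_induct)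
  case (psubset L)
  show ?case
  proof (cases "L = {}")
    case True
    then show ?thesis using assms(2) by simp
  next
    case False
    then obtain v where v: "v \<in> L" by blast
    then have "v \<notin> U" using psubset.prems by blast
    then have del: "L \<union> U - {v} = (L - {v}) \<union> U" by blast
    have lnk: "{u \<in> L \<union> U. u < v \<or> v < u} = {u \<in> L. u < v \<or> v < u} \<union> U"
      using psubset.prems v by blast
    show ?thesis
    proof (rule nonevasive_order_complex_step[of v])
      show "v \<in> L \<union> U" using v by blast
      show "nonevasive (order_complex (L \<union> U - {v}))"
        unfolding del using v psubset.prems by (intro psubset.IH) blast+
      show "nonevasive (order_complex {u \<in> L \<union> U. u < v \<or> v < u})"
        unfolding lnk using v psubset.prems by (intro psubset.IH) blast+
    qed
  qed
qed

text \<open>The complex is a cone, the join of its apex \<open>a\<close> with the other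
  elements.\<close>

lemma nonevasive_order_complex_greatest:
  assumes "finite Q" and "a \<in> Q" and "\<And>u. u \<in> Q \<Longrightarrow> u \<le> a"
  shows "nonevasive (order_complex Q)"
proof -
  have "nonevasive (order_complex ((Q - {a}) \<union> {a}))"
    using assms by (intro nonevasive_order_complex_join)
      (auto simp: order_complex_singleton nonevasive.vertex less_le)
  then show ?thesis using assms(2) by (simp add: insert_absorb)
qed

text \<open>Below a minimal \<open>z\<close> of \<open>R\<close> there are only elements of
  \<open>T\<close>. They form a nonevasive complex, and the link of \<open>z\<close> is its join
  with the elements above \<open>z\<close>.\<close>

lemma nonevasive_order_complex_add_above:
  assumes "finite T" and "finite R" and "T \<inter> R = {}" and "nonevasive (order_complex T)"
    and "\<And>z. z \<in> R \<Longrightarrow> nonevasive (order_complex {u \<in> T. u < z})"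
  shows "nonevasive (order_complex (T \<union> R))"
  using assms(2,3,5)
proof (induction R rule: finite_psubset_induct)
  case (psubset R)
  show ?case
  proof (cases "R = {}")
    case True
    then show ?thesis using assms(4) by simp
  next
    case False
    then obtain z where z: "z \<in> R" "\<And>u. u \<in> R \<Longrightarrow> \<not> u < z"
      using finite_has_minimal[OF psubset.hyps] by (metis less_le)
    then have del: "T \<union> R - {z} = T \<union> (R - {z})"
      using psubset.prems(1) by blast
    have lnk: "{u \<in> T \<union> R. u < z \<or> z < u} = {u \<in> T \<union> R. z < u} \<union> {u \<in> T. u < z}"
      using z(2) by blast
    show ?thesis
    proof (rule nonevasive_order_complex_step[of z])
      show "z \<in> T \<union> R" using z by blast
      show "nonevasive (order_complex (T \<union> R - {z}))"
        unfolding del using z psubset.prems by (intro psubset.IH) blast+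
      show "nonevasive (order_complex {u \<in> T \<union> R. u < z \<or> z < u})"
        unfolding lnk using z assms(1) psubset
        by (intro nonevasive_order_complex_join) (auto intro: less_trans)
    qed
  qed
qed

text \<open>The order dual of the previous argument, with \<open>z\<close> maximal in
  \<open>R\<close>.\<close>

lemma nonevasive_order_complex_add_below:
  assumes "finite T" and "finite R" and "T \<inter> R = {}" and "nonevasive (order_complex T)"
    and "\<And>z. z \<in> R \<Longrightarrow> nonevasive (order_complex {u \<in> T. z < u})"
  shows "nonevasive (order_complex (T \<union> R))"
  using assms(2,3,5)
proof (induction R rule: finite_psubset_induct)
  case (psubset R)
  show ?case
  proof (cases "R = {}")
    case True
    then show ?thesis using assms(4) by simp
  next
    case False
    then obtain z where z: "z \<in> R" "\<And>u. u \<in> R \<Longrightarrow> \<not> z < u"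
      using finite_has_maximal[OF psubset.hyps] by (metis less_le)
    then have del: "T \<union> R - {z} = T \<union> (R - {z})"
      using psubset.prems(1) by blast
    have lnk: "{u \<in> T \<union> R. u < z \<or> z < u} = {u \<in> T \<union> R. u < z} \<union> {u \<in> T. z < u}"
      using z(2) by blast
    show ?thesis
    proof (rule nonevasive_order_complex_step[of z])
      show "z \<in> T \<union> R" using z by blast
      show "nonevasive (order_complex (T \<union> R - {z}))"
        unfolding del using z psubset.prems by (intro psubset.IH) blast+
      show "nonevasive (order_complex {u \<in> T \<union> R. u < z \<or> z < u})"
        unfolding lnk using z assms(1) psubset
        by (intro nonevasive_order_complex_join) (auto intro: less_trans)
    qed
  qed
qed

lemma nonevasive_order_complex_meeting_above:
  fixes x y :: "'a::{finite, bounded_lattice}"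
  assumes "x \<noteq> bot" and "inf x y = bot" and "sup x y \<noteq> top"
  shows "nonevasive (order_complex {z. y < z \<and> z \<noteq> top \<and> inf x z \<noteq> bot})"
    (is "nonevasive (order_complex ?A)")
proof -
  let ?w = "sup x y"
  let ?T = "{z \<in> ?A. z \<le> ?w}" and ?R = "{z \<in> ?A. \<not> z \<le> ?w}"
  \<comment> \<open>Otherwise \<open>x \<le> y\<close>, and then
    \<open>x = inf x y = bot\<close>.\<close>
  have "?w \<noteq> y"
    using assms(1,2) by (metis inf.absorb1 sup.absorb_iff2)
  then have w: "?w \<in> ?T"
    using assms by (simp add: less_le inf_absorb1)
  have "nonevasive (order_complex (?T \<union> ?R))"
  proof (rule nonevasive_order_complex_add_above)
    show "nonevasive (order_complex ?T)"
      using w by (intro nonevasive_order_complex_greatest[of _ ?w]) auto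
    fix z assume z: "z \<in> ?R"
    \<comment> \<open>By absorption \<open>inf x ?w = x\<close>, so cutting \<open>z\<close> down to
      \<open>?w\<close> does not change its meet with \<open>x\<close>. That meet is not
      \<open>bot\<close>, which also separates \<open>inf z ?w\<close> from
      \<open>y\<close>.\<close>
    have "inf x (inf z ?w) = inf x z"
      by (metis inf.commute inf.left_commute inf_sup_absorb)
    moreover from this have "inf z ?w \<noteq> y"
      using z assms(2) by auto
    moreover have "y \<le> inf z ?w" using z by (simp add: less_imp_le)
    moreover have "inf z ?w \<noteq> z"
      using z by (metis (no_types, lifting) inf.cobounded2 mem_Collect_eq)
    moreover have "inf z ?w \<noteq> top" using z by (auto simp: inf_eq_top_iff)
    ultimately have "inf z ?w \<in> {u \<in> ?T. u < z}"
      using z by (simp add: less_le)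
    then show "nonevasive (order_complex {u \<in> ?T. u < z})"
      by (intro nonevasive_order_complex_greatest[of _ "inf z ?w"]) auto
  qed auto
  moreover have "?T \<union> ?R = ?A" by blast
  ultimately show ?thesis by simp
qed

theorem theorem2p1:
  fixes x :: "'a::{finite, bounded_lattice}" and P :: "'a set"
  assumes "x \<notin> {bot, top}"
    and "P = UNIV - complements x"
  shows "nonevasive (order_complex (P - {bot, top})) \<and>
         collapsible (order_complex (P - {bot, top}))"
proof -
  let ?T = "{z. bot < z \<and> z \<noteq> top \<and> inf x z \<noteq> bot}"
  let ?R = "{y. y \<noteq> bot \<and> inf x y = bot \<and> sup x y \<noteq> top}"
  have "nonevasive (order_complex (?T \<union> ?R))"
  proof (rule nonevasive_order_complex_add_below)
    \<comment> \<open>This is the case \<open>y = bot\<close>, where \<open>sup x bot = x\<close>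
      differs from \<open>top\<close>.\<close>
    show "nonevasive (order_complex ?T)"
      using assms(1) by (intro nonevasive_order_complex_meeting_above) auto
    fix y assume y: "y \<in> ?R"
    have "{u \<in> ?T. y < u} = {z. y < z \<and> z \<noteq> top \<and> inf x z \<noteq> bot}"
      by (auto intro: le_less_trans[OF bot_least])
    then show "nonevasive (order_complex {u \<in> ?T. y < u})"
      using y assms(1) nonevasive_order_complex_meeting_above[of x y] by auto
  qed auto
  \<comment> \<open>Elements of \<open>?T\<close> are never complements. An element that meets
    \<open>x\<close> in \<open>bot\<close> is a noncomplement exactly if its join with
    \<open>x\<close> is not \<open>top\<close>, which also rules out \<open>top\<close>
    itself.\<close>
  moreover have "P - {bot, top} = ?T \<union> ?R"
    using assms by (auto simp: complements_def bot_less)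
  ultimately show ?thesis
    using nonevasive_imp_collapsible by auto
qed

end
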